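(* Let $G$ be a finite simple graph of order $n$ and size $m$, and let $k\geq 1$ be an integer. If $k\leq 2\bigl(n-\sqrt{n^{2}-n-2m}\bigr)$ or $\delta(G)\geq k-1$, then $$L_{k}(G)\leq n+\frac{k}{2}-\sqrt{\frac{k^{2}}{4}+(1-k)n+2m},$$ with equality if and only if $G\in\Omega_k$. Furthermore, if $G$ has no isolated vertex, then $\rho_{o}(G)\leq n-\sqrt{2m-n}$, with equality if and only if $G\in\Sigma$.
   Context: $\delta(G)$ is the minimum degree of $G$ and $N[v]$, $N(v)$ are the closed and open neighbourhoods of a vertex $v$. A set $B\subseteq V(G)$ is a $k$-limited packing set if $|N[v]\cap B|\leq k$ for every $v\in V(G)$; $L_k(G)$ is the maximum cardinality of such a set. A set $B\subseteq V(G)$ is an open packing if $N(u)\cap N(v)=\emptyset$ for all distinct $u,v\in B$; $\rho_o(G)$ is the maximum cardinality of an open packing. $\Omega_k$ is the family of all graphs $G$ for which there exists a clique $S\subseteq V(G)$ such that the subgraph induced by $V(G)\setminus S$ is $(k-1)$-regular and every vertex of $S$ has exactly $k$ neighbours in $V(G)\setminus S$. $\Sigma$ is the family of all graphs $G$ for which there exists a clique $S\subseteq V(G)$ such that the subgraph induced by $V(G)\setminus S$ is a disjoint union of copies of $K_2$ and every vertex of $S$ has exactly one neighbour in $V(G)\setminus S$. *)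

theory Defs
  imports Complex_Main "HOL-Library.Disjoint_Sets"
begin

record 'a sgraph =
  verts :: "'a set"
  edges :: "'a set set"

definition simple_graph :: "'a sgraph \<Rightarrow> bool" where
  "simple_graph G \<longleftrightarrow> finite (verts G) \<and> (\<forall>e\<in>edges G. e \<subseteq> verts G \<and> card e = 2)"

definition nbhd :: "'a sgraph \<Rightarrow> 'a \<Rightarrow> 'a set" where
  "nbhd G v = {u \<in> verts G. {u, v} \<in> edges G}"

definition closed_nbhd :: "'a sgraph \<Rightarrow> 'a \<Rightarrow> 'a set" where
  "closed_nbhd G v = insert v (nbhd G v)"

definition degree :: "'a sgraph \<Rightarrow> 'a \<Rightarrow> nat" where
  "degree G v = card (nbhd G v)"

(* Unspecified (Min of the empty set) for the graph without vertices. *)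
definition min_degree :: "'a sgraph \<Rightarrow> nat" where
  "min_degree G = Min (degree G ` verts G)"

definition regular :: "nat \<Rightarrow> 'a sgraph \<Rightarrow> bool" where
  "regular d G \<longleftrightarrow> (\<forall>v\<in>verts G. degree G v = d)"

definition induced :: "'a sgraph \<Rightarrow> 'a set \<Rightarrow> 'a sgraph" where
  "induced G W = \<lparr>verts = verts G \<inter> W, edges = {e \<in> edges G. e \<subseteq> W}\<rparr>"

(* The empty set is a clique. *)
definition clique :: "'a sgraph \<Rightarrow> 'a set \<Rightarrow> bool" where
  "clique G S \<longleftrightarrow> S \<subseteq> verts G \<and> (\<forall>u\<in>S. \<forall>v\<in>S. u \<noteq> v \<longrightarrow> {u, v} \<in> edges G)"

definition limited_packing :: "nat \<Rightarrow> 'a sgraph \<Rightarrow> 'a set \<Rightarrow> bool" where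
  "limited_packing k G B \<longleftrightarrow>
     B \<subseteq> verts G \<and> (\<forall>v\<in>verts G. card (closed_nbhd G v \<inter> B) \<le> k)"

definition limited_packing_number :: "nat \<Rightarrow> 'a sgraph \<Rightarrow> nat" where
  "limited_packing_number k G = Max {card B | B. limited_packing k G B}"

definition open_packing :: "'a sgraph \<Rightarrow> 'a set \<Rightarrow> bool" where
  "open_packing G B \<longleftrightarrow>
     B \<subseteq> verts G \<and> (\<forall>u\<in>B. \<forall>v\<in>B. u \<noteq> v \<longrightarrow> nbhd G u \<inter> nbhd G v = {})"

definition open_packing_number :: "'a sgraph \<Rightarrow> nat" where
  "open_packing_number G = Max {card B | B. open_packing G B}"

(* P consists of the vertex sets of the copies of the complete graph on r vertices:
   an edge joins two vertices exactly when they lie in the same copy. *)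
definition disjoint_union_of_complete :: "nat \<Rightarrow> 'a sgraph \<Rightarrow> bool" where
  "disjoint_union_of_complete r G \<longleftrightarrow>
     (\<exists>P. partition_on (verts G) P \<and> (\<forall>C\<in>P. card C = r) \<and>
          edges G = {e. card e = 2 \<and> (\<exists>C\<in>P. e \<subseteq> C)})"

definition Omega_family :: "nat \<Rightarrow> 'a sgraph set" where
  "Omega_family k = {G. simple_graph G \<and>
     (\<exists>S. clique G S \<and>
          regular (k - 1) (induced G (verts G - S)) \<and>
          (\<forall>v\<in>S. card (nbhd G v \<inter> (verts G - S)) = k))}"

definition Sigma_family :: "'a sgraph set" where
  "Sigma_family = {G. simple_graph G \<and>
     (\<exists>S. clique G S \<and>
          disjoint_union_of_complete 2 (induced G (verts G - S)) \<and>
          (\<forall>v\<in>S. card (nbhd G v \<inter> (verts G - S)) = 1))}"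

end

(*
Idea: let B be a largest set in which every vertex of B has at most a neighbours and every vertex
of S = V - B has at most b. Splitting the degree sum along B and S and bounding the degrees inside
S by |S| - 1 gives
  2m <= a |B| + 2b |S| + |S| (|S| - 1),
with equality iff S is a clique and both degree bounds are attained everywhere. With
c = (2b - a - 1) / 2 this reads c^2 - a n + 2m <= (|S| + c)^2.
Since c >= 0, the right side increases with |S|, so any S attaining equality is as small as possible
and its complement is a largest admissible set. Limited packings are the
case a = k - 1, b = k, open packings the case a = b = 1.
*)
theory Submission
  imports Defs
begin

section \<open>Double counting of degrees and edges\<close>

lemma simple_graph_finite:
  assumes "simple_graph G"
  shows "finite (verts G)" "finite (edges G)" "finite (nbhd G v)"
proof -
  show fV: "finite (verts G)" using assms by (simp add: simple_graph_def)
  have "edges G \<subseteq> Pow (verts G)" using assms by (auto simp: simple_graph_def)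
  then show "finite (edges G)" using fV by (simp add: finite_subset)
  show "finite (nbhd G v)" using fV by (simp add: nbhd_def)
qed

lemma nbhd_subset_verts: "nbhd G v \<subseteq> verts G"
  by (auto simp: nbhd_def)

lemma nbhd_commute: "u \<in> verts G \<Longrightarrow> v \<in> verts G \<Longrightarrow> u \<in> nbhd G v \<longleftrightarrow> v \<in> nbhd G u"
  by (simp add: nbhd_def insert_commute)

lemma not_in_nbhd_self: "simple_graph G \<Longrightarrow> v \<notin> nbhd G v"
  by (auto simp: simple_graph_def nbhd_def)

lemma card_incident_edges:
  assumes "simple_graph G"
  shows "card {e \<in> edges G. v \<in> e} = degree G v"
proof -
  have "bij_betw (\<lambda>u. {u, v}) (nbhd G v) {e \<in> edges G. v \<in> e}"
  proof (rule bij_betw_imageI)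
    show "inj_on (\<lambda>u. {u, v}) (nbhd G v)"
      by (auto simp: inj_on_def doubleton_eq_iff)
    show "(\<lambda>u. {u, v}) ` nbhd G v = {e \<in> edges G. v \<in> e}"
    proof (intro equalityI subsetI)
      fix e assume e: "e \<in> {e \<in> edges G. v \<in> e}"
      then have "card e = 2" "e \<subseteq> verts G" using assms by (auto simp: simple_graph_def)
      then obtain x y where "e = {x, y}" by (auto simp: card_2_iff)
      with e obtain u where "e = {u, v}" by auto
      then show "e \<in> (\<lambda>u. {u, v}) ` nbhd G v"
        using e \<open>e \<subseteq> verts G\<close> by (auto simp: nbhd_def)
    qed (auto simp: nbhd_def)
  qed
  then show ?thesis by (simp add: bij_betw_same_card degree_def)
qed

text \<open>Double counting of the incidences between vertices and edges: every edge has exactly two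
  ends.\<close>

lemma handshake:
  assumes "simple_graph G"
  shows "(\<Sum>v\<in>verts G. degree G v) = 2 * card (edges G)"
proof -
  have "card {v \<in> verts G. v \<in> e} = 2" if "e \<in> edges G" for e
  proof -
    have "{v \<in> verts G. v \<in> e} = e" using assms that by (auto simp: simple_graph_def)
    then show ?thesis using assms that by (simp add: simple_graph_def)
  qed
  then have "(\<Sum>v\<in>verts G. card {e \<in> edges G. v \<in> e}) = 2 * card (edges G)"
    using simple_graph_finite[OF assms] by (intro sum_multicount) auto
  then show ?thesis by (simp add: card_incident_edges[OF assms])
qed

text \<open>Adjacency is symmetric, so both sides count the adjacent pairs in A \<times> B, grouped
  once by the first and once by the second component.\<close>

lemma sum_cross_degrees:
  assumes "simple_graph G" "A \<subseteq> verts G" "B \<subseteq> verts G"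
  shows "(\<Sum>v\<in>A. card (nbhd G v \<inter> B)) = (\<Sum>v\<in>B. card (nbhd G v \<inter> A))"
proof -
  have fin: "finite A" "finite B"
    using simple_graph_finite[OF assms(1)] assms finite_subset by blast+
  have nbB: "nbhd G v \<inter> B = {u \<in> B. u \<in> nbhd G v}" for v by blast
  have "{v \<in> A. u \<in> nbhd G v} = nbhd G u \<inter> A" if "u \<in> B" for u
    using that assms nbhd_commute[of u G] by blast
  then show ?thesis
    unfolding nbB using fin by (intro sum_multicount_gen) auto
qed

text \<open>In the degree sum every edge between B and S is seen from both ends. Moving the count on
  the B side over to S produces the factor 2 and leaves only the degrees inside B in the first
  sum.\<close>

lemma edge_count_split:
  assumes G: "simple_graph G" and B: "B \<subseteq> verts G"
  defines "S \<equiv> verts G - B"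
  shows "2 * card (edges G) = (\<Sum>v\<in>B. card (nbhd G v \<inter> B))
           + (\<Sum>v\<in>S. 2 * card (nbhd G v \<inter> B) + card (nbhd G v \<inter> S))"
proof -
  note fin = simple_graph_finite[OF G]
  have V: "verts G = B \<union> S" and S: "S \<subseteq> verts G" and disj: "B \<inter> S = {}"
    using B by (auto simp: S_def)
  have fBS: "finite B" "finite S" using fin V by (metis finite_Un)+
  have deg: "degree G v = card (nbhd G v \<inter> B) + card (nbhd G v \<inter> S)" for v
  proof -
    have "nbhd G v = (nbhd G v \<inter> B) \<union> (nbhd G v \<inter> S)"
      using nbhd_subset_verts[of G v] V by blast
    then show ?thesis
      unfolding degree_def using fin disj
      by (metis (no_types, lifting) card_Un_disjoint finite_Un inf_assoc inf_bot_right inf_left_commute)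
  qed
  have "2 * card (edges G) = (\<Sum>v\<in>B. degree G v) + (\<Sum>v\<in>S. degree G v)"
    using handshake[OF G] fBS disj by (simp add: V sum.union_disjoint)
  then show ?thesis
    using sum_cross_degrees[OF G B S] by (simp add: deg sum.distrib sum_distrib_left[symmetric])
qed

section \<open>Degree-bounded sets and the edge bound with its equality case\<close>

definition degree_bounded :: "nat \<Rightarrow> nat \<Rightarrow> 'a sgraph \<Rightarrow> 'a set \<Rightarrow> bool" where
  "degree_bounded a b G B \<longleftrightarrow> B \<subseteq> verts G \<and> (\<forall>v\<in>B. card (nbhd G v \<inter> B) \<le> a) \<and>
     (\<forall>v\<in>verts G - B. card (nbhd G v \<inter> B) \<le> b)"

text \<open>The common shape of the two extremal families: a = k - 1, b = k gives the condition of
  \<open>Omega_family k\<close>, and a = b = 1 gives that of \<open>Sigma_family\<close>, once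
  disjoint copies of K_2 are read as 1-regularity.\<close>

definition degree_extremal :: "nat \<Rightarrow> nat \<Rightarrow> 'a sgraph \<Rightarrow> 'a set \<Rightarrow> bool" where
  "degree_extremal a b G S \<longleftrightarrow> clique G S \<and> regular a (induced G (verts G - S)) \<and>
     (\<forall>v\<in>S. card (nbhd G v \<inter> (verts G - S)) = b)"

lemma nbhd_induced: "W \<subseteq> verts G \<Longrightarrow> v \<in> W \<Longrightarrow> nbhd (induced G W) v = nbhd G v \<inter> W"
  by (auto simp: nbhd_def induced_def)

lemma simple_graph_induced: "simple_graph G \<Longrightarrow> simple_graph (induced G W)"
  by (auto simp: simple_graph_def induced_def)

lemma degree_extremal_iff:
  assumes "S \<subseteq> verts G"
  shows "degree_extremal a b G S \<longleftrightarrow> clique G S \<and>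
     (\<forall>v\<in>verts G - S. card (nbhd G v \<inter> (verts G - S)) = a) \<and>
     (\<forall>v\<in>S. card (nbhd G v \<inter> (verts G - S)) = b)"
proof -
  have "verts (induced G (verts G - S)) = verts G - S" by (auto simp: induced_def)
  then show ?thesis
    by (simp add: degree_extremal_def regular_def degree_def nbhd_induced)
qed

text \<open>A vertex v of S is not its own neighbour, so adding v to its neighbours in S gives a
  subset of S that is one larger; it fills S iff v is adjacent to all the rest. Writing + 1 on the
  left avoids truncated subtraction.\<close>

lemma clique_iff_card_nbhd:
  assumes G: "simple_graph G" and S: "S \<subseteq> verts G"
  shows "clique G S \<longleftrightarrow> (\<forall>v\<in>S. card (nbhd G v \<inter> S) + 1 = card S)"
    and "v \<in> S \<Longrightarrow> card (nbhd G v \<inter> S) + 1 \<le> card S"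
proof -
  note fin = simple_graph_finite[OF G]
  have fS: "finite S" using fin S finite_subset by blast
  have ins: "card (nbhd G v \<inter> S) + 1 = card (insert v (nbhd G v \<inter> S))" for v
    using fin not_in_nbhd_self[OF G, of v] by simp
  have sub: "insert v (nbhd G v \<inter> S) \<subseteq> S" if "v \<in> S" for v using that by blast
  show "v \<in> S \<Longrightarrow> card (nbhd G v \<inter> S) + 1 \<le> card S"
    unfolding ins by (intro card_mono fS sub)
  have "card (nbhd G v \<inter> S) + 1 = card S \<longleftrightarrow> (\<forall>u\<in>S. u \<noteq> v \<longrightarrow> {u, v} \<in> edges G)" if "v \<in> S" for v
  proof -
    have "card (nbhd G v \<inter> S) + 1 = card S \<longleftrightarrow> insert v (nbhd G v \<inter> S) = S"
      unfolding ins using card_subset_eq[OF fS sub[OF that]] by auto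
    also have "\<dots> \<longleftrightarrow> (\<forall>u\<in>S. u \<noteq> v \<longrightarrow> {u, v} \<in> edges G)"
      using that S by (auto simp: nbhd_def)
    finally show ?thesis .
  qed
  then show "clique G S \<longleftrightarrow> (\<forall>v\<in>S. card (nbhd G v \<inter> S) + 1 = card S)"
    using S by (auto simp: clique_def)
qed

text \<open>Bounds the split degree sum term by term; equality of the sums forces equality in every
  term, and these are the extremality conditions. The summand \<open>card S\<close> stands on the
  left so that |S| (|S| - 1) becomes a plain square.\<close>

lemma edge_bound:
  assumes G: "simple_graph G" and bd: "degree_bounded a b G B"
  defines "S \<equiv> verts G - B"
  shows "2 * card (edges G) + card S \<le> a * card B + 2 * b * card S + (card S)\<^sup>2" (is ?le)
    and "2 * card (edges G) + card S = a * card B + 2 * b * card S + (card S)\<^sup>2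
         \<longleftrightarrow> degree_extremal a b G S" (is ?iff)
proof -
  have B: "B \<subseteq> verts G" using bd by (simp add: degree_bounded_def)
  have VS: "verts G - S = B" and S: "S \<subseteq> verts G" using B by (auto simp: S_def)
  have fBS: "finite B" "finite S"
    using simple_graph_finite[OF G] B S finite_subset by blast+
  \<comment> \<open>The contribution of a vertex of S to the split sum, raised by 1; summed over S,
    these ones account for the extra \<open>card S\<close>.\<close>
  define f where "f v = 2 * card (nbhd G v \<inter> B) + (card (nbhd G v \<inter> S) + 1)" for v
  note cl = clique_iff_card_nbhd[OF G S]
  have leB: "card (nbhd G v \<inter> B) \<le> a" if "v \<in> B" for v
    using bd that by (simp add: degree_bounded_def)
  have leb: "card (nbhd G v \<inter> B) \<le> b" if "v \<in> S" for v
    using bd that by (simp add: degree_bounded_def S_def)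
  have leS: "f v \<le> 2 * b + card S" if "v \<in> S" for v
    unfolding f_def using leb[OF that] cl(2)[OF that] by linarith
  have count: "2 * card (edges G) + card S = (\<Sum>v\<in>B. card (nbhd G v \<inter> B)) + sum f S"
    using edge_count_split[OF G B] unfolding f_def S_def[symmetric] sum.distrib by simp
  have rhs: "a * card B + 2 * b * card S + (card S)\<^sup>2 = (\<Sum>v\<in>B. a) + (\<Sum>v\<in>S. 2 * b + card S)"
    by (simp add: power2_eq_square algebra_simps)
  have sumB: "(\<Sum>v\<in>B. card (nbhd G v \<inter> B)) \<le> (\<Sum>v\<in>B. a)" by (intro sum_mono leB)
  have sumS: "sum f S \<le> (\<Sum>v\<in>S. 2 * b + card S)" by (intro sum_mono leS)
  show ?le unfolding count rhs using sumB sumS by (rule add_mono)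
  show ?iff
  proof
    assume "2 * card (edges G) + card S = a * card B + 2 * b * card S + (card S)\<^sup>2"
    \<comment> \<open>Two inequalities whose sum is tight are both tight.\<close>
    then have eqs: "(\<Sum>v\<in>B. card (nbhd G v \<inter> B)) = (\<Sum>v\<in>B. a)"
        "sum f S = (\<Sum>v\<in>S. 2 * b + card S)"
      unfolding count rhs using sumB sumS by linarith+
    have "\<forall>v\<in>B. card (nbhd G v \<inter> B) = a"
      using sum_mono_inv[OF eqs(1) leB _ fBS(1)] by blast
    moreover have fS: "f v = 2 * b + card S" if "v \<in> S" for v
      using sum_mono_inv[OF eqs(2) leS that fBS(2)] .
    \<comment> \<open>The same principle inside \<open>f v\<close>: both of its parts are bounded
      separately, so a tight total makes each of them tight.\<close>
    have "card (nbhd G v \<inter> B) = b \<and> card (nbhd G v \<inter> S) + 1 = card S" if "v \<in> S" for v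
      using fS[OF that] leb[OF that] cl(2)[OF that] unfolding f_def by linarith
    ultimately show "degree_extremal a b G S"
      by (simp add: degree_extremal_iff[OF S] VS cl(1))
  next
    assume "degree_extremal a b G S"
    then have "\<forall>v\<in>B. card (nbhd G v \<inter> B) = a" "\<forall>v\<in>S. f v = 2 * b + card S"
      by (auto simp: degree_extremal_iff[OF S] VS cl(1) f_def)
    then show "2 * card (edges G) + card S = a * card B + 2 * b * card S + (card S)\<^sup>2"
      unfolding count rhs by simp
  qed
qed

section \<open>The general bound on the largest degree-bounded set\<close>

lemma Max_card_attained:
  assumes "finite V" "\<And>B. P B \<Longrightarrow> B \<subseteq> V" "P {}"
  obtains B where "P B" "Max {card B | B. P B} = card B" "\<forall>C. P C \<longrightarrow> card C \<le> card B"
proof -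
  have eq: "{card B | B. P B} = card ` {B. P B}" by auto
  have "{B. P B} \<subseteq> Pow V" using assms(2) by auto
  then have fin: "finite {card B | B. P B}" unfolding eq using assms(1) by (simp add: finite_subset)
  \<comment> \<open>The empty set is admissible, so \<open>Max\<close> is taken over a nonempty set
    and is a genuine maximum.\<close>
  moreover have "{card B | B. P B} \<noteq> {}" using assms(3) by auto
  ultimately have "Max {card B | B. P B} \<in> {card B | B. P B}" by (rule Max_in)
  then obtain B where B: "P B" "Max {card B | B. P B} = card B" by blast
  have "card C \<le> Max {card B | B. P B}" if "P C" for C
    using fin that by (intro Max_ge) auto
  then have "card C \<le> card B" if "P C" for C
    using that unfolding B(2) by blast
  then show ?thesis using that[OF B] by blast
qed

text \<open>Solves the edge bound, a quadratic inequality in |S|, for |S| by completing the square.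
  The hypothesis on a and b says exactly that c \<ge> 0.\<close>

theorem degree_bounded_number_bound:
  fixes G :: "'a sgraph" and a b :: nat
  assumes G: "simple_graph G" and ab: "a + 1 \<le> 2 * b"
  defines "L \<equiv> real (Max {card B | B. degree_bounded a b G B})"
    and "n \<equiv> real (card (verts G))" and "m \<equiv> real (card (edges G))"
    and "c \<equiv> (2 * real b - real a - 1) / 2"
  shows "L \<le> n + c - sqrt (c\<^sup>2 - real a * n + 2 * m)"
    and "L = n + c - sqrt (c\<^sup>2 - real a * n + 2 * m) \<longleftrightarrow> (\<exists>S. degree_extremal a b G S)"
proof -
  note fin = simple_graph_finite[OF G]
  define D where "D = c\<^sup>2 - real a * n + 2 * m"
  define s where "s B = real (card (verts G - B))" for B
  have c0: "c \<ge> 0" using ab unfolding c_def by simp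
  have s0: "s B \<ge> 0" for B by (simp add: s_def)
  have card_eq: "real (card B) = n - s B" if "B \<subseteq> verts G" for B
    using that fin card_mono[OF fin(1) that]
    by (simp add: s_def n_def card_Diff_subset finite_subset of_nat_diff)
  have bound: "D \<le> (s B + c)\<^sup>2"
    and iff: "D = (s B + c)\<^sup>2 \<longleftrightarrow> degree_extremal a b G (verts G - B)"
    if bd: "degree_bounded a b G B" for B
  proof -
    have sub: "B \<subseteq> verts G" using bd by (simp add: degree_bounded_def)
    note eb = edge_bound[OF G bd]
    have n: "n = s B + real (card B)" using card_eq[OF sub] by simp
    \<comment> \<open>Completing the square: the slack in the edge bound is exactly (s + c)^2 - D,
      so its inequality and its equality case both carry over.\<close>
    have real_rhs: "real (a * card B + 2 * b * card (verts G - B) + (card (verts G - B))\<^sup>2)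
        = real (2 * card (edges G) + card (verts G - B)) + ((s B + c)\<^sup>2 - D)"
      by (simp add: s_def[symmetric] D_def m_def[symmetric] n c_def power2_eq_square field_simps)
    show "D \<le> (s B + c)\<^sup>2" using eb(1) real_rhs by linarith
    have "D = (s B + c)\<^sup>2 \<longleftrightarrow> 2 * card (edges G) + card (verts G - B)
        = a * card B + 2 * b * card (verts G - B) + (card (verts G - B))\<^sup>2"
      using real_rhs by linarith
    then show "D = (s B + c)\<^sup>2 \<longleftrightarrow> degree_extremal a b G (verts G - B)"
      by (simp only: eb(2))
  qed
  have sub: "C \<subseteq> verts G" if "degree_bounded a b G C" for C
    using that by (simp add: degree_bounded_def)
  have "degree_bounded a b G {}" by (simp add: degree_bounded_def)
  with fin(1) sub obtain B where B: "degree_bounded a b G B"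
    and L: "Max {card B | B. degree_bounded a b G B} = card B"
    and max: "\<forall>C. degree_bounded a b G C \<longrightarrow> card C \<le> card B"
    using Max_card_attained[of "verts G" "degree_bounded a b G"] by blast
  have LB: "L = n - s B" by (simp add: L_def L card_eq[OF sub[OF B]])
  have sq: "sqrt ((s B + c)\<^sup>2) = s B + c" using s0[of B] c0 by simp
  \<comment> \<open>In HOL \<open>sqrt\<close> is extended to negative arguments as an odd function
    and is strictly increasing on all reals, so this comparison and the equivalence
    \<open>sqrt_iff\<close> hold whatever the sign of D.\<close>
  have "sqrt D \<le> s B + c"
    using real_sqrt_le_mono[OF bound[OF B]] unfolding sq .
  then show "L \<le> n + c - sqrt (c\<^sup>2 - real a * n + 2 * m)"
    unfolding D_def[symmetric] LB by linarith
  have sqrt_iff: "sqrt D = s B + c \<longleftrightarrow> D = (s B + c)\<^sup>2"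
    using real_sqrt_eq_iff[of D "(s B + c)\<^sup>2"] unfolding sq .
  have "D = (s B + c)\<^sup>2 \<longleftrightarrow> (\<exists>S. degree_extremal a b G S)"
  proof
    assume "\<exists>S. degree_extremal a b G S"
    then obtain S where ex: "degree_extremal a b G S" by blast
    then have S: "S \<subseteq> verts G" by (simp add: degree_extremal_def clique_def)
    define C where "C = verts G - S"
    have SC: "verts G - C = S" using S by (auto simp: C_def)
    have C: "degree_bounded a b G C"
      using ex SC by (auto simp: degree_extremal_iff[OF S] degree_bounded_def C_def)
    \<comment> \<open>Maximality of B starts a sandwich: D \<le> (s B + c)^2 \<le> (s C + c)^2 =
      D.\<close>
    have "s B \<le> s C"
      using max[rule_format, OF C] card_eq[OF sub[OF B]] card_eq[OF sub[OF C]] by linarith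
    then have "(s B + c)\<^sup>2 \<le> (s C + c)\<^sup>2" using s0[of B] c0 by (intro power_mono) auto
    moreover have "D = (s C + c)\<^sup>2" using iff[OF C] ex SC by simp
    ultimately show "D = (s B + c)\<^sup>2" using bound[OF B] by linarith
  qed (use iff[OF B] in blast)
  then show "L = n + c - sqrt (c\<^sup>2 - real a * n + 2 * m) \<longleftrightarrow> (\<exists>S. degree_extremal a b G S)"
    unfolding D_def[symmetric] LB sqrt_iff[symmetric] by (auto simp: algebra_simps)
qed

section \<open>Packings as degree-bounded sets\<close>

lemma limited_packing_iff_degree_bounded:
  assumes G: "simple_graph G" and "k \<ge> 1"
  shows "limited_packing k G B \<longleftrightarrow> degree_bounded (k - 1) k G B"
proof (cases "B \<subseteq> verts G")
  case True
  have "closed_nbhd G v \<inter> B = nbhd G v \<inter> B" if "v \<notin> B" for v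
    using that by (auto simp: closed_nbhd_def)
  \<comment> \<open>A vertex of B uses up one of its k places itself, which is why the bound inside
    B is k - 1 while outside it stays k.\<close>
  moreover have "card (closed_nbhd G v \<inter> B) = card (nbhd G v \<inter> B) + 1" if "v \<in> B" for v
  proof -
    have "closed_nbhd G v \<inter> B = insert v (nbhd G v \<inter> B)"
      using that by (auto simp: closed_nbhd_def)
    then show ?thesis using simple_graph_finite[OF G] not_in_nbhd_self[OF G] by simp
  qed
  moreover have "j + 1 \<le> k \<longleftrightarrow> j \<le> k - 1" for j using \<open>k \<ge> 1\<close> by linarith
  ultimately have "card (closed_nbhd G v \<inter> B) \<le> k \<longleftrightarrow>
      (if v \<in> B then card (nbhd G v \<inter> B) \<le> k - 1 else card (nbhd G v \<inter> B) \<le> k)" for v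
    by simp
  then show ?thesis
    using True by (auto simp: limited_packing_def degree_bounded_def)
qed (simp add: limited_packing_def degree_bounded_def)

text \<open>Vertices u and v share a neighbour w iff both lie in the neighbourhood of w. Hence
  disjoint neighbourhoods mean that every vertex w, in B or not, has at most one neighbour in
  B.\<close>

lemma open_packing_iff_degree_bounded:
  assumes G: "simple_graph G"
  shows "open_packing G B \<longleftrightarrow> degree_bounded 1 1 G B"
proof -
  have "card (nbhd G w \<inter> B) \<le> 1 \<longleftrightarrow> (\<forall>u\<in>B. \<forall>v\<in>B. w \<in> nbhd G u \<inter> nbhd G v \<longrightarrow> u = v)"
    if "B \<subseteq> verts G" "w \<in> verts G" for w
  proof -
    have "card (nbhd G w \<inter> B) \<le> 1 \<longleftrightarrow> (\<forall>u\<in>nbhd G w \<inter> B. \<forall>v\<in>nbhd G w \<inter> B. u = v)"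
      using simple_graph_finite[OF G] by (simp add: card_le_Suc0_iff_eq)
    then show ?thesis using that nbhd_commute[of _ G w] by blast
  qed
  then have eq: "B \<subseteq> verts G \<Longrightarrow> (\<forall>w\<in>verts G. card (nbhd G w \<inter> B) \<le> 1) \<longleftrightarrow>
      (\<forall>u\<in>B. \<forall>v\<in>B. u \<noteq> v \<longrightarrow> nbhd G u \<inter> nbhd G v = {})"
    using nbhd_subset_verts[of G] by (auto; blast)
  have bounded: "degree_bounded 1 1 G B \<longleftrightarrow>
      B \<subseteq> verts G \<and> (\<forall>w\<in>verts G. card (nbhd G w \<inter> B) \<le> 1)"
    by (auto simp del: One_nat_def simp: degree_bounded_def)
  show ?thesis
    unfolding open_packing_def bounded by (rule conj_cong[OF refl eq[symmetric]])
qed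

section \<open>The extremal families\<close>

lemma Omega_family_iff:
  "simple_graph G \<Longrightarrow> G \<in> Omega_family k \<longleftrightarrow> (\<exists>S. degree_extremal (k - 1) k G S)"
  by (simp add: Omega_family_def degree_extremal_def)

text \<open>In a union of copies of K_2 the only neighbour of a vertex is the other element of its
  part. Conversely, 1-regularity puts each vertex on exactly one edge, so the edges themselves serve
  as the parts.\<close>

lemma disjoint_union_K2_iff_regular:
  assumes H: "simple_graph H"
  shows "disjoint_union_of_complete 2 H \<longleftrightarrow> regular 1 H"
proof
  assume "disjoint_union_of_complete 2 H"
  then obtain P where P: "partition_on (verts H) P" "\<forall>C\<in>P. card C = 2"
    and E: "edges H = {e. card e = 2 \<and> (\<exists>C\<in>P. e \<subseteq> C)}"
    by (auto simp: disjoint_union_of_complete_def)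
  have "card (nbhd H v) = 1" if v: "v \<in> verts H" for v
  proof -
    obtain C where C: "C \<in> P" "v \<in> C" using P(1) v by (auto simp: partition_on_def)
    have "card C = 2" using C P(2) by blast
    then obtain w where w: "C = {v, w}" "v \<noteq> w" using C(2) by (auto simp: card_2_iff)
    have "nbhd H v = {w}"
    proof (intro equalityI subsetI)
      fix u assume "u \<in> nbhd H v"
      then obtain C' where C': "C' \<in> P" "{u, v} \<subseteq> C'" and "card {u, v} = 2"
        by (auto simp: nbhd_def E)
      then have "u \<noteq> v" by auto
      have "C' = C" using C C' P(1) by (auto simp: partition_on_def disjoint_def)
      then show "u \<in> {w}" using C' w \<open>u \<noteq> v\<close> by auto
    next
      fix u assume "u \<in> {w}"
      then show "u \<in> nbhd H v"
        using C w P(1) by (auto simp: nbhd_def E partition_on_def card_2_iff intro: bexI[of _ C])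
    qed
    then show ?thesis by simp
  qed
  then show "regular 1 H" by (simp add: regular_def degree_def)
next
  assume reg: "regular 1 H"
  have card2: "card e = 2" "finite e" "e \<subseteq> verts H" if "e \<in> edges H" for e
    using H that by (auto simp: simple_graph_def intro: finite_subset)
  have ex1: "card {e \<in> edges H. v \<in> e} = 1" if "v \<in> verts H" for v
    using reg that card_incident_edges[OF H] by (simp add: regular_def)
  have "partition_on (verts H) (edges H)"
  proof (rule partition_onI)
    show "\<Union> (edges H) = verts H"
    proof (intro equalityI subsetI)
      fix v assume "v \<in> verts H"
      then have "card {e \<in> edges H. v \<in> e} \<noteq> 0" using ex1 by simp
      then have "{e \<in> edges H. v \<in> e} \<noteq> {}" using card.empty by metis
      then show "v \<in> \<Union> (edges H)" by blast
    qed (use card2 in blast)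
    show "{} \<notin> edges H" using card2(1)[of "{}"] by auto
    fix p q assume pq: "p \<in> edges H" "q \<in> edges H" "p \<noteq> q"
    show "disjnt p q"
    proof (rule ccontr)
      assume "\<not> disjnt p q"
      then obtain v where v: "v \<in> p" "v \<in> q" by (auto simp: disjnt_def)
      then have "card {e \<in> edges H. v \<in> e} = 1" using ex1 card2(3)[OF pq(1)] by blast
      then obtain e where e: "{e \<in> edges H. v \<in> e} = {e}" by (rule card_1_singletonE)
      have "p \<in> {e}" "q \<in> {e}" unfolding e[symmetric] using pq v by simp_all
      then show False using pq(3) by simp
    qed
  qed
  \<comment> \<open>A two-element subset of an edge is that edge.\<close>
  moreover have "edges H = {e. card e = 2 \<and> (\<exists>C\<in>edges H. e \<subseteq> C)}"
  proof (intro equalityI subsetI)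
    fix e assume "e \<in> {e. card e = 2 \<and> (\<exists>C\<in>edges H. e \<subseteq> C)}"
    then obtain C where C: "C \<in> edges H" "e \<subseteq> C" "card e = 2" by blast
    then have "e = C" using card2[of C] by (intro card_subset_eq) simp_all
    then show "e \<in> edges H" using C(1) by simp
  qed (use card2(1) in blast)
  ultimately show "disjoint_union_of_complete 2 H"
    using card2(1) unfolding disjoint_union_of_complete_def by blast
qed

lemma Sigma_family_iff:
  "simple_graph G \<Longrightarrow> G \<in> Sigma_family \<longleftrightarrow> (\<exists>S. degree_extremal 1 1 G S)"
  by (simp add: Sigma_family_def degree_extremal_def
      disjoint_union_K2_iff_regular[OF simple_graph_induced])

section \<open>Specialisation to limited and open packings\<close>

theorem theorem2:
  fixes G :: "'a sgraph" and n m k :: nat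
  assumes "simple_graph G"
    and "n = card (verts G)"
    and "m = card (edges G)"
    and "k \<ge> 1"
  shows "(real k \<le> 2 * (real n - sqrt ((real n)\<^sup>2 - real n - 2 * real m)) \<or> min_degree G \<ge> k - 1
      \<longrightarrow> real (limited_packing_number k G)
            \<le> real n + real k / 2 - sqrt ((real k)\<^sup>2 / 4 + (1 - real k) * real n + 2 * real m)
        \<and> (real (limited_packing_number k G)
            = real n + real k / 2 - sqrt ((real k)\<^sup>2 / 4 + (1 - real k) * real n + 2 * real m)
           \<longleftrightarrow> G \<in> Omega_family k))
    \<and> ((\<forall>v\<in>verts G. degree G v \<noteq> 0)
      \<longrightarrow> real (open_packing_number G) \<le> real n - sqrt (2 * real m - real n)
        \<and> (real (open_packing_number G) = real n - sqrt (2 * real m - real n)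
           \<longleftrightarrow> G \<in> Sigma_family))"
proof -
  note G = assms(1)
  \<comment> \<open>The constant c for a = k - 1, b = k; since k \<ge> 1, the natural number k - 1
    is not truncated.\<close>
  have c: "(2 * real k - real (k - 1) - 1) / 2 = real k / 2"
    using assms(4) by (simp add: of_nat_diff)
  have D: "(real k / 2)\<^sup>2 - real (k - 1) * real n + 2 * real m
      = (real k)\<^sup>2 / 4 + (1 - real k) * real n + 2 * real m"
    using assms(4) by (simp add: of_nat_diff power_divide algebra_simps)
  have lp: "limited_packing_number k G = Max {card B | B. degree_bounded (k - 1) k G B}"
    by (simp only: limited_packing_number_def limited_packing_iff_degree_bounded[OF G assms(4)])
  have op: "open_packing_number G = Max {card B | B. degree_bounded 1 1 G B}"
    by (simp only: open_packing_number_def open_packing_iff_degree_bounded[OF G])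
  have "k - 1 + 1 \<le> 2 * k" using assms(4) by linarith
  note limited = degree_bounded_number_bound[OF G this, folded assms(2,3) lp Omega_family_iff[OF G],
      unfolded c D]
  \<comment> \<open>For a = b = 1 the constant c is 0, and the radicand reduces to 2m - n.\<close>
  have "1 + 1 \<le> 2 * (1::nat)" by simp
  from degree_bounded_number_bound[OF G this, folded assms(2,3) op Sigma_family_iff[OF G]]
  have packing: "real (open_packing_number G) \<le> real n - sqrt (2 * real m - real n)"
      "real (open_packing_number G) = real n - sqrt (2 * real m - real n) \<longleftrightarrow> G \<in> Sigma_family"
    by simp_all
  show ?thesis by (intro conjI impI limited packing)
qed

end
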